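(* Fix $\alpha\in(0,1)$ and an integer $\lambda\ge0$. For the online time-critical task scheduling with calibration problem in which all jobs are $\alpha$-short window jobs (i.e., $d_j-r_j<\alpha T+\lambda$), with unit processing times and activation time $\lambda$, there exists an online algorithm with competitive ratio $(e+1)(\lambda+1)\lceil\frac{2}{1-\alpha}\rceil$.
   Context: Problem: unlimited identical machines; discrete time. A calibration started at integer time $t$ occupies $[t,t+\lambda+T)$, with activation interval $[t,t+\lambda)$ and calibrated interval $[t+\lambda,t+\lambda+T)$ ($T$ a positive integer). Machines process jobs only while calibrated, one job at a time. Each job $j$ has integer release time $r_j$, processing time $1$, integer deadline $d_j$ with $d_j-r_j\ge1+\lambda$; scheduling $j$ at integer time $\tau$ in a calibrated slot is feasible iff $r_j\le\tau$ and $\tau+1\le d_j$. Jobs arrive online (revealed at release time). Objective: minimize the number of calibrations while feasibly scheduling all jobs. An online algorithm is $c$-competitive if there is a constant $a$ with $ALG(Ins)\le c\cdot OPT(Ins)+a$ for every instance, where $OPT(Ins)$ is the minimum number of calibrations. *)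

theory Defs
  imports Complex_Main
begin

text \<open>The identifier only tells apart jobs with equal release times and deadlines.\<close>

record job =
  ident :: nat
  release :: int
  deadline :: int

text \<open>
  A decision for one time step: the machines on which a calibration is started at that time, and
  the job (if any) that each machine processes during the unit slot beginning at that time.
  The unlimited supply of identical machines is indexed by the natural numbers.
\<close>

record decision =
  starts :: "nat set"
  processes :: "nat \<Rightarrow> job option"

type_synonym schedule = "int \<Rightarrow> decision"

definition calibrations :: "schedule \<Rightarrow> (int \<times> nat) set" where
  "calibrations S = {(t, m). m \<in> starts (S t)}"

definition cost :: "schedule \<Rightarrow> nat" where
  "cost S = card (calibrations S)"

text \<open>Throughout, \<open>lam\<close> is the activation time and \<open>T\<close> the length of a calibrated interval.\<close>

definition calibrated :: "int \<Rightarrow> int \<Rightarrow> schedule \<Rightarrow> nat \<Rightarrow> int \<Rightarrow> bool" where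
  "calibrated lam T S m \<tau> \<longleftrightarrow> (\<exists>t. (t, m) \<in> calibrations S \<and> \<tau> \<in> {t + lam ..< t + lam + T})"

text \<open>
  Finiteness of the set of calibrations is demanded because the cardinality of an infinite set
  is 0 and would make such a schedule free of charge.
\<close>

definition feasible :: "int \<Rightarrow> int \<Rightarrow> job set \<Rightarrow> schedule \<Rightarrow> bool" where
  "feasible lam T J S \<longleftrightarrow>
     finite (calibrations S) \<and>
     (\<forall>m t t'. (t, m) \<in> calibrations S \<and> (t', m) \<in> calibrations S \<and> t \<noteq> t' \<longrightarrow>
        {t ..< t + lam + T} \<inter> {t' ..< t' + lam + T} = {}) \<and>
     (\<forall>\<tau> m j. processes (S \<tau>) m = Some j \<longrightarrow>
        j \<in> J \<and> calibrated lam T S m \<tau> \<and> release j \<le> \<tau> \<and> \<tau> + 1 \<le> deadline j) \<and>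
     (\<forall>j\<in>J. \<exists>!(\<tau>, m). processes (S \<tau>) m = Some j)"

definition opt :: "int \<Rightarrow> int \<Rightarrow> job set \<Rightarrow> nat" where
  "opt lam T J = (LEAST n. \<exists>S. feasible lam T J S \<and> cost S = n)"

text \<open>
  A deterministic online algorithm knows \<open>T\<close> and chooses its decision at time \<open>t\<close> from the set of
  jobs released up to time \<open>t\<close>. Its own earlier decisions are functions of earlier such
  sets, hence need not be passed separately.
\<close>

type_synonym online_algorithm = "int \<Rightarrow> int \<Rightarrow> job set \<Rightarrow> decision"

definition run :: "online_algorithm \<Rightarrow> int \<Rightarrow> job set \<Rightarrow> schedule" where
  "run A T J = (\<lambda>t. A T t {j \<in> J. release j \<le> t})"

text \<open>An instance is a pair of the length \<open>T\<close> and the job set.\<close>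

definition competitive ::
    "int \<Rightarrow> (int \<times> job set) set \<Rightarrow> online_algorithm \<Rightarrow> real \<Rightarrow> bool" where
  "competitive lam Inst A c \<longleftrightarrow>
     (\<exists>a::real. \<forall>(T, J)\<in>Inst.
        feasible lam T J (run A T J) \<and>
        real (cost (run A T J)) \<le> c * real (opt lam T J) + a)"

definition instances :: "int \<Rightarrow> (int \<times> job set) set" where
  "instances lam =
     {(T, J). 0 < T \<and> finite J \<and> (\<forall>j\<in>J. 1 + lam \<le> deadline j - release j)}"

definition short_window_instances :: "real \<Rightarrow> int \<Rightarrow> (int \<times> job set) set" where
  "short_window_instances \<alpha> lam =
     {(T, J) \<in> instances lam.
        \<forall>j\<in>J. of_int (deadline j - release j) < \<alpha> * of_int T + of_int lam}"

text \<open>Every instance is feasible, so the minimum defining \<open>opt\<close> is attained.\<close>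

lemma feasible_exists:
  assumes "(T, J) \<in> instances lam" "0 \<le> lam"
  shows "\<exists>S. feasible lam T J S"
proof -
  have fin: "finite J" and T: "0 < T"
    and win: "\<And>j. j \<in> J \<Longrightarrow> 1 + lam \<le> deadline j - release j"
    using assms by (auto simp: instances_def)
  obtain f :: "job \<Rightarrow> nat" where f: "inj_on f J"
    using finite_imp_inj_to_nat_seg[OF fin] by blast
  define S :: schedule where "S = (\<lambda>t. \<lparr>starts = f ` {j \<in> J. release j = t},
    processes = (\<lambda>m. if \<exists>j\<in>J. f j = m \<and> release j + lam = t
                     then Some (the_inv_into J f m) else None)\<rparr>)"
  have proc: "processes (S \<tau>) m = Some j \<longleftrightarrow> j \<in> J \<and> f j = m \<and> release j + lam = \<tau>" for \<tau> m j
    unfolding S_def using the_inv_into_f_f[OF f] f by (auto dest: inj_onD)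
  have cal: "calibrations S = (\<lambda>j. (release j, f j)) ` J"
    by (auto simp: calibrations_def S_def)
  have "calibrated lam T S (f j) (release j + lam)" if "j \<in> J" for j
    unfolding calibrated_def cal using that T by (intro exI[of _ "release j"]) auto
  then have "feasible lam T J S"
    unfolding feasible_def proc cal using fin win assms(2) f
    by (fastforce simp: inj_on_def)
  then show ?thesis by blast
qed

lemma opt_attained:
  assumes "(T, J) \<in> instances lam" "0 \<le> lam"
  shows "\<exists>S. feasible lam T J S \<and> cost S = opt lam T J"
    and "feasible lam T J S \<Longrightarrow> opt lam T J \<le> cost S"
proof -
  have "\<exists>n S. feasible lam T J S \<and> cost S = n"
    using feasible_exists[OF assms] by blast
  then show "\<exists>S. feasible lam T J S \<and> cost S = opt lam T J"
    unfolding opt_def by (rule LeastI_ex)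
  show "feasible lam T J S \<Longrightarrow> opt lam T J \<le> cost S"
    unfolding opt_def by (rule Least_le) blast
qed

end

theory Submission
  imports Defs "HOL-Library.Nat_Bijection"
begin

text \<open>
  A machine calibrated upon the arrival of a job is ready \<open>lam\<close> steps later, so every release time
  is increased by \<open>lam\<close>. Cut time into blocks of length \<open>B = T - \<lfloor>\<alpha> T\<rfloor>\<close>. The shrunk windows of
  the jobs released in one block lie in an interval of length \<open>T\<close>, so each block is served by its
  own machines, each calibrated once. Within a block the algorithm keeps three times as many
  machines as the largest density (number of known jobs with window in an interval, over its length)
  and runs earliest deadline first; the constant 3 suffices because \<open>2 / ln 2 < 3\<close>.

  Conversely, the \<open>lam + 1\<close> translates of the calibrations of an optimal schedule by \<open>0, \<dots>, lam\<close>
  accommodate the shrunk windows, so the density within a block is at most the number of translates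
  that meet the block's interval of length \<open>T\<close>. Each translate meets at most \<open>\<lceil>2 / (1 - \<alpha>)\<rceil>\<close> of
  these intervals. As \<open>3 \<le> e + 1\<close>, the ratio follows, with additive constant 0.
\<close>

section \<open>Earliest deadline first with unit jobs\<close>

fun earliest :: "('a \<Rightarrow> nat) \<Rightarrow> nat \<Rightarrow> 'a set \<Rightarrow> 'a set" where
  "earliest d 0 X = {}"
| "earliest d (Suc m) X =
     (if X = {} then {} else insert (arg_min_on d X) (earliest d m (X - {arg_min_on d X})))"

lemma earliest_subset: "finite X \<Longrightarrow> earliest d m X \<subseteq> X"
proof (induction m arbitrary: X)
  case (Suc m)
  then show ?case
    using Suc.IH[of "X - {arg_min_on d X}"] arg_min_if_finite(1)[of X d] by auto
qed simp

lemma card_earliest: "finite X \<Longrightarrow> card (earliest d m X) = min m (card X)"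
proof (induction m arbitrary: X)
  case (Suc m)
  show ?case
  proof (cases "X = {}")
    case False
    let ?x = "arg_min_on d X"
    have x: "?x \<in> X"
      using False Suc.prems by (simp add: arg_min_if_finite(1))
    have sub: "earliest d m (X - {?x}) \<subseteq> X - {?x}"
      using Suc.prems by (intro earliest_subset) simp
    then have "?x \<notin> earliest d m (X - {?x})" "finite (earliest d m (X - {?x}))"
      using Suc.prems by (auto intro: finite_subset)
    moreover have "card X > 0"
      using False Suc.prems by (simp add: card_gt_0_iff)
    ultimately show ?thesis
      using False Suc.IH[of "X - {?x}"] Suc.prems x by (auto simp: min_def)
  qed simp
qed simp

lemma earliest_le:
  "finite X \<Longrightarrow> x \<in> earliest d m X \<Longrightarrow> y \<in> X - earliest d m X \<Longrightarrow> d x \<le> d y"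
proof (induction m arbitrary: X)
  case (Suc m)
  then have "X \<noteq> {}" by auto
  then show ?case
    using Suc.prems Suc.IH[of "X - {arg_min_on d X}"] arg_min_least[of X y d] by auto
qed simp

text \<open>\<open>m n\<close> is the capacity at time \<open>n\<close> and \<open>A n\<close> the
  set of jobs available then; jobs picked strictly before \<open>n\<close> count as served.\<close>

primrec served :: "('a \<Rightarrow> nat) \<Rightarrow> (nat \<Rightarrow> nat) \<Rightarrow> (nat \<Rightarrow> 'a set) \<Rightarrow> nat \<Rightarrow> 'a set" where
  "served d m A 0 = {}"
| "served d m A (Suc n) = served d m A n \<union> earliest d (m n) (A n - served d m A n)"

text \<open>Only what happens before \<open>n\<close> enters the recursion. This is what later
  allows an online algorithm to recompute its own past.\<close>

lemma served_cong:
  "(\<And>k. k < n \<Longrightarrow> m k = m' k \<and> A k = A' k) \<Longrightarrow> served d m A n = served d m' A' n"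
  by (induction n) auto

lemma served_mono: "p \<le> q \<Longrightarrow> served d m A p \<subseteq> served d m A q"
  by (rule lift_Suc_mono_le[of "served d m A"]) auto

lemma served_eq_Union:
  "served d m A n = (\<Union>k<n. earliest d (m k) (A k - served d m A k))"
  by (induction n) (auto simp: lessThan_Suc)

lemma earliest_served_disjoint:
  assumes "\<And>n. finite (A n)" "p \<noteq> q"
  shows "earliest d (m p) (A p - served d m A p) \<inter> earliest d (m q) (A q - served d m A q) = {}"
proof -
  have *: "earliest d (m p) (A p - served d m A p) \<inter> earliest d (m q) (A q - served d m A q) = {}"
    if "p < q" for p q
  proof -
    have "earliest d (m p) (A p - served d m A p) \<subseteq> served d m A q"
      using that by (subst (2) served_eq_Union) auto
    moreover have "earliest d (m q) (A q - served d m A q) \<subseteq> A q - served d m A q"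
      using assms(1) by (intro earliest_subset) simp
    ultimately show ?thesis by blast
  qed
  show ?thesis
    using *[of p q] *[of q p] assms(2) by (metis Int_commute linorder_neqE_nat)
qed

text \<open>
  If a job is late at time \<open>D\<close>, go back to the last time \<open>a\<close> at which all earlier jobs with deadline
  at most \<open>D\<close> are done. From \<open>a\<close> to \<open>D\<close> the whole capacity serves such jobs released after \<open>a\<close>,
  and still one of them is left over, against the capacity bound on \<open>{a..<D}\<close>.
\<close>
lemma served_before_deadline:
  fixes r d :: "'a \<Rightarrow> nat"
  assumes fin: "finite K"
    and capacity: "\<And>a D. card {j \<in> K. a \<le> r j \<and> d j \<le> D} \<le> (\<Sum>s = a..<D. m s)"
    and j: "j \<in> K" "r j < d j"
  shows "j \<in> served d m (\<lambda>n. {j \<in> K. r j \<le> n}) (d j)"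
proof (rule ccontr)
  define A where "A = (\<lambda>n. {j \<in> K. r j \<le> n})"
  define D where "D = d j"
  define E where "E = (\<lambda>n. earliest d (m n) (A n - served d m A n))"
  define clean where "clean = (\<lambda>x. \<forall>j\<in>K. d j \<le> D \<longrightarrow> r j < x \<longrightarrow> j \<in> served d m A x)"
  assume "j \<notin> served d m (\<lambda>n. {j \<in> K. r j \<le> n}) (d j)"
  then have j_late: "j \<notin> served d m A D" by (simp add: A_def D_def)
  then have dirty: "\<not> clean D"
    unfolding clean_def D_def using j by auto
  have finA: "finite (A n)" for n
    using fin by (simp add: A_def)
  have E_sub: "E n \<subseteq> A n - served d m A n" for n
    unfolding E_def using finA by (intro earliest_subset) simp
  define a where "a = Max {x. x \<le> D \<and> clean x}"
  have ne: "{x. x \<le> D \<and> clean x} \<noteq> {}" "finite {x. x \<le> D \<and> clean x}"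
    by (auto simp: clean_def intro!: exI[of _ 0])
  have a: "a \<le> D" "clean a"
    using Max_in[OF ne(2,1)] by (auto simp: a_def)
  then have "a < D" using dirty by (metis nat_less_le)
  have after_a: "\<not> clean x" if "a < x" "x \<le> D" for x
  proof
    assume "clean x"
    then have "x \<le> a"
      unfolding a_def using that(2) ne(2) by (intro Max_ge) simp_all
    then show False using that(1) by simp
  qed
  let ?L = "{j \<in> K. a \<le> r j \<and> d j \<le> D}"
  have E: "card (E s) = m s \<and> E s \<subseteq> ?L" if s: "s \<in> {a..<D}" for s
  proof -
    \<comment> \<open>Failure of \<open>clean (Suc s)\<close> gives a job due by \<open>D\<close>
      that is known at \<open>s\<close> and still unserved afterwards. So the capacity at
      \<open>s\<close> is exhausted, by jobs due no later than \<open>y\<close>.\<close>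
    obtain y where y: "y \<in> K" "d y \<le> D" "r y < Suc s" "y \<notin> served d m A (Suc s)"
      using after_a[of "Suc s"] s unfolding clean_def by auto
    then have y': "y \<in> (A s - served d m A s) - E s"
      by (auto simp: A_def E_def)
    then have "E s \<noteq> A s - served d m A s" by (metis DiffD1 DiffD2)
    then have "card (E s) < card (A s - served d m A s)"
      using E_sub[of s] finA[of s] by (intro psubset_card_mono) auto
    moreover have "card (E s) = min (m s) (card (A s - served d m A s))"
      unfolding E_def using finA[of s] by (intro card_earliest) simp
    ultimately have "card (E s) = m s" by linarith
    moreover have "x \<in> ?L" if x: "x \<in> E s" for x
    proof -
      have "d x \<le> d y"
        using x y' finA[of s] unfolding E_def by (intro earliest_le) auto
      then have dx: "d x \<le> D" using y(2) by simp
      have xK: "x \<in> K" and "x \<notin> served d m A s"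
        using E_sub[of s] x by (auto simp: A_def)
      moreover have "served d m A a \<subseteq> served d m A s"
        using s by (intro served_mono) simp
      ultimately have "\<not> r x < a"
        using a(2) dx unfolding clean_def by auto
      then show ?thesis
        using dx xK by simp
    qed
    ultimately show ?thesis by blast
  qed
  have j_in: "j \<in> ?L"
  proof -
    have "served d m A a \<subseteq> served d m A D"
      using \<open>a < D\<close> by (intro served_mono) simp
    then have "\<not> r j < a"
      using a(2) j(1) j_late unfolding clean_def D_def by auto
    then show ?thesis
      using j(1) by (simp add: D_def)
  qed
  have "E s \<subseteq> served d m A D" if "s \<in> {a..<D}" for s
    using that by (subst served_eq_Union) (auto simp: E_def)
  then have sub: "insert j (\<Union>s\<in>{a..<D}. E s) \<subseteq> ?L" and nin: "j \<notin> (\<Union>s\<in>{a..<D}. E s)"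
    using E j_in j_late by blast+
  have finE: "finite (E s)" for s
    using E_sub[of s] finA[of s] by (auto intro: finite_subset)
  have "card (\<Union>s\<in>{a..<D}. E s) = (\<Sum>s\<in>{a..<D}. card (E s))"
    using earliest_served_disjoint[of A] finA finE by (intro card_UN_disjoint) (auto simp: E_def)
  also have "\<dots> = (\<Sum>s\<in>{a..<D}. m s)"
    using E by simp
  finally have "card (insert j (\<Union>s\<in>{a..<D}. E s)) = Suc (\<Sum>s\<in>{a..<D}. m s)"
    using nin finE by simp
  moreover have "card (insert j (\<Union>s\<in>{a..<D}. E s)) \<le> card ?L"
    using sub fin by (intro card_mono) auto
  ultimately show False
    using capacity[of a D] by simp
qed

section \<open>Three times the current density is enough capacity\<close>

definition density :: "('a \<Rightarrow> nat) \<Rightarrow> ('a \<Rightarrow> nat) \<Rightarrow> 'a set \<Rightarrow> nat" where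
  "density r d X = (LEAST R. \<forall>a b. card {j \<in> X. a \<le> r j \<and> d j \<le> b} \<le> R * (b - a))"

lemma density_le:
  "(\<And>a b. card {j \<in> X. a \<le> r j \<and> d j \<le> b} \<le> R * (b - a)) \<Longrightarrow> density r d X \<le> R"
  unfolding density_def by (rule Least_le) blast

lemma density_empty [simp]: "density r d {} = 0"
  using density_le[of "{}" r d 0] by simp

text \<open>The least bound is attained because \<open>card X\<close> is a bound: if
  \<open>b \<le> a\<close>, where the truncated \<open>b - a\<close> is 0, no window fits since
  \<open>r j < d j\<close>.\<close>

lemma card_le_density:
  assumes "finite X" "\<And>j. j \<in> X \<Longrightarrow> r j < d j"
  shows "card {j \<in> X. a \<le> r j \<and> d j \<le> b} \<le> density r d X * (b - a)"
proof -
  have "card {j \<in> X. a \<le> r j \<and> d j \<le> b} \<le> card X * (b - a)" for a b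
  proof (cases "a < b")
    case True
    have "card {j \<in> X. a \<le> r j \<and> d j \<le> b} \<le> card X"
      using assms(1) by (intro card_mono) auto
    also have "\<dots> \<le> card X * (b - a)" using True by (simp add: Suc_leI)
    finally show ?thesis .
  next
    case False
    have "{j \<in> X. a \<le> r j \<and> d j \<le> b} = {}"
    proof (rule equals0I)
      fix j assume "j \<in> {j \<in> X. a \<le> r j \<and> d j \<le> b}"
      then show False using False assms(2)[of j] by simp
    qed
    then show ?thesis by (simp only: card.empty le0)
  qed
  then have "\<exists>R. \<forall>a b. card {j \<in> X. a \<le> r j \<and> d j \<le> b} \<le> R * (b - a)" by blast
  then show ?thesis unfolding density_def by (rule LeastI2_ex) blast
qed

lemma density_mono:
  assumes "X \<subseteq> Y" "finite Y" "\<And>j. j \<in> Y \<Longrightarrow> r j < d j"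
  shows "density r d X \<le> density r d Y"
proof (rule density_le)
  fix a b
  have "card {j \<in> X. a \<le> r j \<and> d j \<le> b} \<le> card {j \<in> Y. a \<le> r j \<and> d j \<le> b}"
    using assms(1,2) by (intro card_mono) auto
  also have "\<dots> \<le> density r d Y * (b - a)"
    using assms(2,3) by (rule card_le_density)
  finally show "card {j \<in> X. a \<le> r j \<and> d j \<le> b} \<le> density r d Y * (b - a)" .
qed

text \<open>These sums decrease to \<open>ln 2\<close>, which exceeds \<open>2 / 3\<close>. Half of
  this bound is the share \<open>1 / 3\<close> of a job that leads to the capacity factor 3.\<close>

lemma sum_inverse_doubling_ge:
  assumes "1 \<le> p"
  shows "2 / 3 \<le> (\<Sum>u = p..<2 * p. 1 / real u)"
proof -
  \<comment> \<open>As the sums decrease, induction needs a correction term that drops at least as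
    fast. This one gives equality at \<open>p = 2\<close> and fails at \<open>p = 1\<close>, which
    is treated separately.\<close>
  have ge: "2 / 3 + 1 / (4 * real p - 2) \<le> (\<Sum>u = p..<2 * p. 1 / real u)" if "2 \<le> p" for p
    using that
  proof (induction p rule: dec_induct)
    case base
    show ?case by (simp add: eval_nat_numeral atLeastLessThanSuc)
  next
    case (step p)
    have "(\<Sum>u = p..<2 * p + 2. 1 / real u) = 1 / real p + (\<Sum>u = Suc p..<2 * p + 2. 1 / real u)"
      using step.hyps by (intro sum.atLeast_Suc_lessThan) simp
    moreover have "(\<Sum>u = p..<2 * p + 2. 1 / real u) =
        (\<Sum>u = p..<2 * p. 1 / real u) + 1 / (2 * real p) + 1 / (2 * real p + 1)"
      by (simp add: atLeastLessThanSuc)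
    ultimately have "(\<Sum>u = Suc p..<2 * Suc p. 1 / real u) =
        (\<Sum>u = p..<2 * p. 1 / real u) + 1 / (2 * real p) + 1 / (2 * real p + 1) - 1 / real p"
      by simp
    moreover have "1 / (4 * real p + 2) \<le>
        1 / (4 * real p - 2) + 1 / (2 * real p) + 1 / (2 * real p + 1) - 1 / real p"
    proof -
      define x where "x = real p"
      have x: "2 \<le> x" using step.hyps by (simp add: x_def)
      have "1 / (4 * x - 2) + 1 / (2 * x) + 1 / (2 * x + 1) - 1 / x - 1 / (4 * x + 2) =
          1 / (2 * x * (2 * x - 1) * (2 * x + 1))"
      proof -
        have "1 / (4 * x - 2) = (1 / 2) * (1 / (2 * x - 1))"
          "1 / (4 * x + 2) = (1 / 2) * (1 / (2 * x + 1))"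
          using x by (simp_all add: field_simps)
        moreover have "x \<noteq> 0" "2 * x - 1 \<noteq> 0" "2 * x + 1 \<noteq> 0" using x by auto
        ultimately show ?thesis
          by (simp add: divide_simps) (simp add: algebra_simps)
      qed
      also have "\<dots> \<ge> 0" using x by simp
      finally show ?thesis by (simp add: x_def)
    qed
    ultimately show ?case
      using step.IH by (simp add: algebra_simps)
  qed
  show ?thesis
  proof (cases "2 \<le> p")
    case True
    then have "0 \<le> 1 / (4 * real p - 2)" by simp
    then show ?thesis using ge[OF True] by linarith
  next
    case False
    then have "p = 1" using assms by simp
    then show ?thesis by (simp add: eval_nat_numeral atLeastLessThanSuc)
  qed
qed

text \<open>
  At time \<open>D - u\<close> the jobs released in \<open>{D - 2 * u..D - u}\<close> are known, so the density is at least
  their number over \<open>2 * u\<close>. A job released at \<open>D - i\<close> is counted for all \<open>u\<close> with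
  \<open>u \<le> i \<le> 2 * u\<close>, hence contributes at least \<open>1 / 3\<close> to the sum of the densities.
\<close>
lemma card_le_sum_density:
  assumes fin: "finite K" and win: "\<And>j. j \<in> K \<Longrightarrow> r j < d j"
  shows "card {j \<in> K. a \<le> r j \<and> d j \<le> D} \<le> (\<Sum>s = a..<D. 3 * density r d {j \<in> K. r j \<le> s})"
proof -
  let ?X = "{j \<in> K. a \<le> r j \<and> d j \<le> D}"
  let ?P = "\<lambda>j s. D - 2 * (D - s) \<le> r j \<and> r j \<le> s"
  have finX: "finite ?X" using fin by simp
  have dens: "(\<Sum>j\<in>?X. if ?P j s then 1 / (2 * real (D - s)) else 0)
      \<le> real (density r d {j \<in> K. r j \<le> s})" if s: "s \<in> {a..<D}" for s
  proof -
    have "card {j \<in> ?X. ?P j s} \<le>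
        card {j \<in> {j \<in> K. r j \<le> s}. D - 2 * (D - s) \<le> r j \<and> d j \<le> D}"
      using fin by (intro card_mono) auto
    also have "\<dots> \<le> density r d {j \<in> K. r j \<le> s} * (D - (D - 2 * (D - s)))"
      using fin win by (intro card_le_density) auto
    \<comment> \<open>Natural subtraction may cut the left end of the interval off at 0, so its
      length is at most \<open>2 * (D - s)\<close>.\<close>
    also have "\<dots> \<le> density r d {j \<in> K. r j \<le> s} * (2 * (D - s))"
      by (intro mult_left_mono) auto
    finally have le: "card {j \<in> ?X. ?P j s} \<le> density r d {j \<in> K. r j \<le> s} * (2 * (D - s))" .
    have "real (card {j \<in> ?X. ?P j s}) \<le>
        real (density r d {j \<in> K. r j \<le> s}) * (2 * real (D - s))"
      using of_nat_mono[OF le, where 'a = real] by (simp only: of_nat_mult of_nat_numeral)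
    moreover have "0 < 2 * real (D - s)" using s by auto
    ultimately have "real (card {j \<in> ?X. ?P j s}) / (2 * real (D - s)) \<le>
        real (density r d {j \<in> K. r j \<le> s})"
      by (simp add: pos_divide_le_eq)
    moreover have "(\<Sum>j\<in>?X. if ?P j s then 1 / (2 * real (D - s)) else 0) =
        real (card {j \<in> ?X. ?P j s}) / (2 * real (D - s))"
      by (subst sum.inter_filter[OF finX, symmetric]) simp
    ultimately show ?thesis by simp
  qed
  have job: "1 / 3 \<le> (\<Sum>s = a..<D. if ?P j s then 1 / (2 * real (D - s)) else 0)"
    if j: "j \<in> ?X" for j
  proof -
    define i where "i = D - r j"
    \<comment> \<open>Half of \<open>i\<close>, rounded up: every \<open>u\<close> in
      \<open>{p..<2 * p}\<close> then satisfies \<open>u \<le> i\<close> and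
      \<open>i \<le> 2 * u\<close>.\<close>
    define p where "p = (i + 1) div 2"
    have i: "1 \<le> i" "i \<le> D - a" "r j = D - i" "i \<le> D"
      using j win[of j] by (auto simp: i_def)
    then have p: "1 \<le> p" "2 * p \<le> i + 1" "i \<le> 2 * p" by (auto simp: p_def)
    have "1 / 3 \<le> (\<Sum>u = p..<2 * p. 1 / real u) / 2"
      using sum_inverse_doubling_ge[OF p(1)] by simp
    also have "\<dots> = (\<Sum>u = p..<2 * p. 1 / (2 * real u))"
      by (simp add: sum_divide_distrib mult.commute)
    also have "\<dots> = (\<Sum>s\<in>(\<lambda>u. D - u) ` {p..<2 * p}. 1 / (2 * real (D - s)))"
      using p i by (subst sum.reindex) (auto simp: inj_on_def intro!: sum.cong)
    also have "\<dots> \<le> (\<Sum>s\<in>{s \<in> {a..<D}. ?P j s}. 1 / (2 * real (D - s)))"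
      using p i by (intro sum_mono2) auto
    also have "\<dots> = (\<Sum>s = a..<D. if ?P j s then 1 / (2 * real (D - s)) else 0)"
      by (rule sum.inter_filter) simp
    finally show ?thesis .
  qed
  have "real (card ?X) / 3 = (\<Sum>j\<in>?X. 1 / 3)" by simp
  also have "\<dots> \<le> (\<Sum>j\<in>?X. \<Sum>s = a..<D. if ?P j s then 1 / (2 * real (D - s)) else 0)"
    using job by (rule sum_mono)
  also have "\<dots> = (\<Sum>s = a..<D. \<Sum>j\<in>?X. if ?P j s then 1 / (2 * real (D - s)) else 0)"
    by (rule sum.swap)
  also have "\<dots> \<le> (\<Sum>s = a..<D. real (density r d {j \<in> K. r j \<le> s}))"
    using dens by (rule sum_mono)
  finally have "real (card ?X) \<le> real (\<Sum>s = a..<D. 3 * density r d {j \<in> K. r j \<le> s})"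
    by (simp add: sum_distrib_left[symmetric])
  then show ?thesis by linarith
qed

section \<open>Grouping jobs by release time\<close>

text \<open>Here \<open>s\<close> is shifted time: the jobs released by real time \<open>t\<close>
  are \<open>known lam J (t + lam)\<close>.\<close>

definition known :: "int \<Rightarrow> job set \<Rightarrow> int \<Rightarrow> job set" where
  "known lam J s = {j \<in> J. release j + lam \<le> s}"

definition group :: "int \<Rightarrow> int \<Rightarrow> job set \<Rightarrow> int \<Rightarrow> job set" where
  "group lam B J i = {j \<in> J. (release j + lam) div B = i}"

definition rel :: "int \<Rightarrow> int \<Rightarrow> int \<Rightarrow> job \<Rightarrow> nat" where
  "rel lam B i j = nat (release j + lam - i * B)"

definition due :: "int \<Rightarrow> int \<Rightarrow> job \<Rightarrow> nat" where
  "due B i j = nat (deadline j - i * B)"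

definition demand :: "int \<Rightarrow> int \<Rightarrow> job set \<Rightarrow> int \<Rightarrow> nat" where
  "demand lam B J i = density (rel lam B i) (due B i) (group lam B J i)"

definition finished :: "int \<Rightarrow> int \<Rightarrow> job set \<Rightarrow> int \<Rightarrow> nat \<Rightarrow> job set" where
  "finished lam B J i =
     served (due B i) (\<lambda>n. 3 * demand lam B (known lam J (i * B + int n)) i)
       (\<lambda>n. group lam B (known lam J (i * B + int n)) i)"

definition batch :: "int \<Rightarrow> int \<Rightarrow> job set \<Rightarrow> int \<Rightarrow> nat \<Rightarrow> job set" where
  "batch lam B J i n =
     earliest (due B i) (3 * demand lam B (known lam J (i * B + int n)) i)
       (group lam B (known lam J (i * B + int n)) i - finished lam B J i n)"

lemma known_known: "s' \<le> s \<Longrightarrow> known lam (known lam J s) s' = known lam J s'"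
  by (auto simp: known_def)

text \<open>Jobs finished before step \<open>n\<close> depend on the knowledge up to step
  \<open>n - 1\<close> only, hence the bound \<open>s + 1\<close>.\<close>

lemma finished_known:
  assumes "i * B + int n \<le> s + 1"
  shows "finished lam B (known lam J s) i n = finished lam B J i n"
  unfolding finished_def using assms by (intro served_cong) (simp add: known_known)

lemma batch_known:
  assumes "i * B + int n \<le> s"
  shows "batch lam B (known lam J s) i n = batch lam B J i n"
  unfolding batch_def using assms by (simp add: finished_known known_known)

text \<open>Machine \<open>m\<close> is the \<open>snd (slot m)\<close>-th machine reserved for block \<open>fst (slot m)\<close>.\<close>
definition slot :: "nat \<Rightarrow> int \<times> nat" where
  "slot m = (int_decode (fst (prod_decode m)), snd (prod_decode m))"

lemma slot_prod_encode [simp]: "slot (prod_encode (int_encode i, n)) = (i, n)"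
  by (simp add: slot_def)

lemma slot_eq_iff: "slot m = (i, n) \<longleftrightarrow> m = prod_encode (int_encode i, n)"
  by (auto simp: slot_def)

text \<open>An arbitrary enumeration of \<open>Q\<close> assigns its jobs to the first
  \<open>card Q\<close> machines of a block. It depends on \<open>Q\<close> alone, so the choice is
  reproducible.\<close>

definition pick :: "'a set \<Rightarrow> nat \<Rightarrow> 'a option" where
  "pick Q n = (if n < card Q then Some ((SOME f. bij_betw f {0..<card Q} Q) n) else None)"

lemma pick_bij:
  assumes "finite Q"
  obtains f where "bij_betw f {0..<card Q} Q"
    "\<And>n. pick Q n = (if n < card Q then Some (f n) else None)"
proof -
  have "bij_betw (SOME f. bij_betw f {0..<card Q} Q) {0..<card Q} Q"
    using ex_bij_betw_nat_finite[OF assms] by (rule someI_ex)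
  then show ?thesis using that by (simp add: pick_def)
qed

lemma pick_SomeD:
  assumes "finite Q" "pick Q n = Some x"
  shows "x \<in> Q" "n < card Q"
proof -
  obtain f where f: "bij_betw f {0..<card Q} Q"
    "\<And>n. pick Q n = (if n < card Q then Some (f n) else None)"
    using pick_bij[OF assms(1)] by blast
  show n: "n < card Q" using f(2)[of n] assms(2) by (simp split: if_splits)
  then show "x \<in> Q"
    using f(2)[of n] assms(2) bij_betwE[OF f(1)] by auto
qed

lemma pick_ex1:
  assumes "finite Q" "x \<in> Q"
  shows "\<exists>!n. pick Q n = Some x"
proof -
  obtain f where f: "bij_betw f {0..<card Q} Q"
    "\<And>n. pick Q n = (if n < card Q then Some (f n) else None)"
    using pick_bij[OF assms(1)] by blast
  then obtain n where "n < card Q" "f n = x"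
    using assms(2) unfolding bij_betw_def by (metis (no_types, lifting) atLeastLessThan_iff imageE)
  then show ?thesis
    using f by (intro ex1I[of _ n]) (auto simp: bij_betw_def inj_on_def split: if_splits)
qed

text \<open>\<open>K\<close> holds the jobs released by \<open>t\<close>. Machine \<open>n\<close>
  of a block is started when three times the demand first exceeds \<open>n\<close>; the previous
  demand is recomputed from \<open>K\<close> without the jobs released at \<open>t\<close>. Starting
  uses all of \<open>K\<close>, so that machines are ready at \<open>t + lam\<close>, whereas
  processing uses only jobs with shifted release at most \<open>t\<close>.\<close>

definition block_decision :: "int \<Rightarrow> int \<Rightarrow> int \<Rightarrow> job set \<Rightarrow> decision" where
  "block_decision lam B t K =
    \<lparr>starts = {m. case slot m of (i, n) \<Rightarrow>
        3 * demand lam B (known lam K (t + lam - 1)) i \<le> n \<and> n < 3 * demand lam B K i},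
     processes = (\<lambda>m. case slot m of (i, n) \<Rightarrow>
        if i * B \<le> t then pick (batch lam B K i (nat (t - i * B))) n else None)\<rparr>"

text \<open>The condition confines \<open>i * B\<close> to \<open>2 * T - 1\<close> consecutive
  integers. It says that the intervals of length \<open>T\<close> starting at \<open>x\<close> and
  at \<open>i * B\<close> meet.\<close>

lemma card_near_multiples:
  fixes x T B :: int
  assumes "0 < B" "0 < T"
  shows "finite {i. \<bar>x - i * B\<bar> < T} \<and> int (card {i. \<bar>x - i * B\<bar> < T}) \<le> (2 * T - 2) div B + 1"
proof -
  define h where "h = (x + T - 1) div B"
  define q where "q = (2 * T - 2) div B"
  have q: "0 \<le> q" using assms by (simp add: q_def pos_imp_zdiv_nonneg_iff)
  have hB: "h * B \<le> x + T - 1"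
    using div_mult_mod_eq[of "x + T - 1" B] pos_mod_sign[OF assms(1), of "x + T - 1"]
    unfolding h_def by linarith
  have "{i. \<bar>x - i * B\<bar> < T} \<subseteq> {h - q..h}"
  proof
    fix i assume "i \<in> {i. \<bar>x - i * B\<bar> < T}"
    then have i: "i * B \<le> x + T - 1" "x - T + 1 \<le> i * B" by auto
    have "i \<le> h"
      using zdiv_mono1[OF i(1) assms(1)] assms(1) by (simp add: h_def)
    moreover have "(h - i) * B \<le> 2 * T - 2"
      using i hB by (simp add: algebra_simps)
    then have "h - i \<le> q"
      using zdiv_mono1[of "(h - i) * B" "2 * T - 2" B] assms(1) by (simp add: q_def)
    ultimately show "i \<in> {h - q..h}" by simp
  qed
  then have fin: "finite {i. \<bar>x - i * B\<bar> < T}" and "card {i. \<bar>x - i * B\<bar> < T} \<le> card {h - q..h}"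
    by (blast intro: finite_subset card_mono finite_atLeastAtMost_int)+
  then have "card {i. \<bar>x - i * B\<bar> < T} \<le> nat (q + 1)" by simp
  then show ?thesis using fin q unfolding q_def[symmetric] by linarith
qed

section \<open>Serving each block of jobs on its own machines\<close>

locale short_jobs =
  fixes lam T B :: int and J :: "job set"
  assumes finite_J: "finite J" and lam: "0 \<le> lam" and B: "0 < B" and T: "0 < T"
    and window: "\<And>j. j \<in> J \<Longrightarrow> release j + lam < deadline j"
    and short: "\<And>j. j \<in> J \<Longrightarrow> deadline j \<le> release j + lam + T - B"
begin

abbreviation G where "G \<equiv> group lam B J"

lemma G_D:
  assumes "j \<in> G i"
  shows "j \<in> J" "i * B \<le> release j + lam" "deadline j < i * B + T"
    "rel lam B i j < due B i j" "(release j + lam) div B = i"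
proof -
  have j: "j \<in> J" "(release j + lam) div B = i" using assms by (auto simp: group_def)
  have "release j + lam = i * B + (release j + lam) mod B"
    using div_mult_mod_eq[of "release j + lam" B] j(2) by simp
  moreover have "0 \<le> (release j + lam) mod B" "(release j + lam) mod B < B"
    using B by simp_all
  ultimately have "i * B \<le> release j + lam \<and> release j + lam < i * B + B" by linarith
  then show "j \<in> J" "i * B \<le> release j + lam" "deadline j < i * B + T"
    "rel lam B i j < due B i j" "(release j + lam) div B = i"
    using j short[of j] window[of j] by (auto simp: rel_def due_def)
qed

lemma finite_G: "finite (G i)"
  using finite_J by (simp add: group_def)

lemma group_known: "group lam B (known lam J (i * B + int n)) i = {j \<in> G i. rel lam B i j \<le> n}"
proof -
  have "release j + lam \<le> i * B + int n \<longleftrightarrow> rel lam B i j \<le> n" if "j \<in> G i" for j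
    using G_D(2)[OF that] by (auto simp: rel_def)
  then show ?thesis by (auto simp: group_def known_def)
qed

lemma finished_eq:
  "finished lam B J i =
     served (due B i) (\<lambda>n. 3 * density (rel lam B i) (due B i) {j \<in> G i. rel lam B i j \<le> n})
       (\<lambda>n. {j \<in> G i. rel lam B i j \<le> n})"
  by (simp add: finished_def demand_def group_known)

lemma batch_eq:
  "batch lam B J i n =
     earliest (due B i) (3 * density (rel lam B i) (due B i) {j \<in> G i. rel lam B i j \<le> n})
       ({j \<in> G i. rel lam B i j \<le> n} - finished lam B J i n)"
  by (simp add: batch_def demand_def group_known)

lemma batch_subset: "batch lam B J i n \<subseteq> {j \<in> G i. rel lam B i j \<le> n}"
proof -
  have "batch lam B J i n \<subseteq> {j \<in> G i. rel lam B i j \<le> n} - finished lam B J i n"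
    unfolding batch_eq using finite_G by (intro earliest_subset) simp
  then show ?thesis by blast
qed

lemma finite_batch: "finite (batch lam B J i n)"
  by (rule finite_subset[OF batch_subset]) (simp add: finite_G)

lemma batch_disjoint: "p \<noteq> q \<Longrightarrow> batch lam B J i p \<inter> batch lam B J i q = {}"
  unfolding batch_eq finished_eq using finite_G by (intro earliest_served_disjoint) auto

text \<open>Earliest deadline first meets all deadlines because three times the current density
  meets its capacity condition.\<close>

lemma batch_before_due:
  assumes "j \<in> G i"
  shows "\<exists>n < due B i j. j \<in> batch lam B J i n"
proof -
  have "j \<in> finished lam B J i (due B i j)"
    unfolding finished_eq using assms finite_G G_D(4)
    by (intro served_before_deadline card_le_sum_density) auto
  then show ?thesis
    unfolding finished_eq batch_eq by (subst (asm) served_eq_Union) auto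
qed

lemma batch_ex1:
  assumes "j \<in> G i"
  shows "\<exists>!n. j \<in> batch lam B J i n"
  using batch_before_due[OF assms] batch_disjoint by blast

text \<open>The batches are chosen without checking deadlines. No job is late because it lies in a
  single batch, and one batch before its deadline contains it.\<close>

lemma batch_due:
  assumes "j \<in> batch lam B J i n"
  shows "n < due B i j"
proof -
  have "j \<in> G i" using assms batch_subset by blast
  then show ?thesis
    using batch_before_due[of j i] batch_ex1[of j i] assms by metis
qed

definition level :: "int \<Rightarrow> int \<Rightarrow> nat" where
  "level i s = 3 * demand lam B (known lam J s) i"

lemma card_batch: "card (batch lam B J i n) \<le> level i (i * B + int n)"
  unfolding batch_def level_def using finite_J
  by (subst card_earliest) (auto simp: group_def known_def)

lemma demand_mono:
  assumes "K \<subseteq> K'" "K' \<subseteq> J"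
  shows "demand lam B K i \<le> demand lam B K' i"
  unfolding demand_def
proof (rule density_mono)
  show "group lam B K i \<subseteq> group lam B K' i" using assms by (auto simp: group_def)
  have "group lam B K' i \<subseteq> G i" using assms by (auto simp: group_def)
  then show "finite (group lam B K' i)"
    "\<And>j. j \<in> group lam B K' i \<Longrightarrow> rel lam B i j < due B i j"
    using finite_G G_D(4) by (auto intro: finite_subset)
qed

lemma level_mono: "s \<le> s' \<Longrightarrow> level i s \<le> level i s'"
  unfolding level_def by (intro mult_left_mono demand_mono) (auto simp: known_def)

lemma level_le_demand: "level i s \<le> 3 * demand lam B J i"
  unfolding level_def by (intro mult_left_mono demand_mono) (auto simp: known_def)

lemma level_before_block: "s < i * B \<Longrightarrow> level i s = 0"
proof -
  assume "s < i * B"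
  then have "group lam B (known lam J s) i = {}"
    using G_D(2) by (fastforce simp: group_def known_def)
  then show ?thesis by (simp add: level_def demand_def)
qed

section \<open>Feasibility and cost of the online schedule\<close>

definition sched :: schedule where
  "sched t = block_decision lam B t (known lam J (t + lam))"

lemma calibrations_sched:
  "(t, m) \<in> calibrations sched \<longleftrightarrow>
     level (fst (slot m)) (t + lam - 1) \<le> snd (slot m) \<and> snd (slot m) < level (fst (slot m)) (t + lam)"
  by (simp add: calibrations_def sched_def block_decision_def level_def known_known split: prod.split)

lemma processes_sched:
  "processes (sched t) m = Some j \<longleftrightarrow>
     fst (slot m) * B \<le> t \<and>
     pick (batch lam B J (fst (slot m)) (nat (t - fst (slot m) * B))) (snd (slot m)) = Some j"
  using lam by (auto simp: sched_def block_decision_def batch_known split: prod.split)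

text \<open>The level of a block is monotone in time, so it passes the index of a machine only
  once.\<close>

lemma calibration_unique:
  assumes "(t, m) \<in> calibrations sched" "(t', m) \<in> calibrations sched"
  shows "t = t'"
proof -
  have "\<not> t < t'" if "(t, m) \<in> calibrations sched" "(t', m) \<in> calibrations sched" for t t'
    using that level_mono[of "t + lam" "t' + lam - 1" "fst (slot m)"]
    unfolding calibrations_sched by auto
  then show ?thesis using assms by (meson linorder_less_linear)
qed

text \<open>Since each machine is calibrated at most once, it suffices to count machines, and only
  blocks containing jobs have any.\<close>

lemma calibrations_sched_bound:
  defines "I \<equiv> (\<lambda>j. (release j + lam) div B) ` J"
  shows "finite (calibrations sched) \<and> cost sched \<le> 3 * (\<Sum>i\<in>I. demand lam B J i)"
proof -
  let ?M = "(\<lambda>(i, n). prod_encode (int_encode i, n)) ` (SIGMA i:I. {..<3 * demand lam B J i})"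
  have finI: "finite I" using finite_J by (simp add: I_def)
  have inj: "inj_on snd (calibrations sched)"
    using calibration_unique by (auto simp: inj_on_def)
  have sub: "snd ` calibrations sched \<subseteq> ?M"
  proof
    fix m assume "m \<in> snd ` calibrations sched"
    then obtain t where t: "(t, m) \<in> calibrations sched" by auto
    obtain i n where s: "slot m = (i, n)" by fastforce
    have n: "n < 3 * demand lam B J i"
      using t s level_le_demand[of i "t + lam"] by (auto simp: calibrations_sched)
    moreover have "i \<in> I"
    proof (rule ccontr)
      assume "i \<notin> I"
      then have "G i = {}" by (auto simp: group_def I_def)
      then show False using n by (simp add: demand_def)
    qed
    moreover have "m = prod_encode (int_encode i, n)" using s by (simp add: slot_eq_iff)
    ultimately show "m \<in> ?M" by force
  qed
  have finM: "finite ?M" using finI by auto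
  have "card (calibrations sched) = card (snd ` calibrations sched)"
    using inj by (simp add: card_image)
  also have "\<dots> \<le> card ?M" using sub finM by (rule card_mono[rotated])
  also have "\<dots> \<le> card (SIGMA i:I. {..<3 * demand lam B J i})"
    using finI by (intro card_image_le) auto
  also have "\<dots> = 3 * (\<Sum>i\<in>I. demand lam B J i)"
    using finI by (simp add: sum_distrib_left)
  finally show ?thesis
    using finite_imageD[OF finite_subset[OF sub finM] inj] by (simp add: cost_def)
qed

lemma processes_schedD:
  assumes "processes (sched \<tau>) m = Some j"
  shows "j \<in> J" "calibrated lam T sched m \<tau>" "release j \<le> \<tau>" "\<tau> + 1 \<le> deadline j"
proof -
  obtain i n where s: "slot m = (i, n)" by fastforce
  define k where "k = nat (\<tau> - i * B)"
  have p: "i * B \<le> \<tau>" "pick (batch lam B J i k) n = Some j"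
    using assms s by (auto simp: processes_sched k_def)
  then have \<tau>: "\<tau> = i * B + int k" by (simp add: k_def)
  have j: "j \<in> batch lam B J i k" and n: "n < card (batch lam B J i k)"
    using pick_SomeD[OF finite_batch p(2)] by auto
  have jG: "j \<in> G i" and r: "rel lam B i j \<le> k" using j batch_subset by blast+
  show "j \<in> J" by (rule G_D(1)[OF jG])
  show "release j \<le> \<tau>" using r G_D(2)[OF jG] lam by (simp add: \<tau> rel_def)
  show d: "\<tau> + 1 \<le> deadline j" using batch_due[OF j] by (simp add: \<tau> due_def)
  have ex: "n < level i (i * B + int k)" using n card_batch[of i k] by simp
  \<comment> \<open>The first step at which the level exceeds \<open>n\<close>. The calibration
    started \<open>lam\<close> earlier is active from then on, and lasts long enough because all
    deadlines of the group lie before \<open>i * B + T\<close>.\<close>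
  define q where "q = (LEAST q. n < level i (i * B + int q))"
  have q: "n < level i (i * B + int q)" "q \<le> k"
    unfolding q_def using ex by (rule LeastI, rule Least_le)
  have "level i (i * B + int q - 1) \<le> n"
  proof (cases q)
    case 0
    then show ?thesis by (simp add: level_before_block)
  next
    case (Suc q')
    then have "\<not> n < level i (i * B + int q')"
      using not_less_Least[of q' "\<lambda>q. n < level i (i * B + int q)"] by (simp add: q_def)
    then show ?thesis using Suc by simp
  qed
  then have "(i * B + int q - lam, m) \<in> calibrations sched"
    using q(1) s by (simp add: calibrations_sched)
  moreover have "\<tau> \<in> {i * B + int q - lam + lam..<i * B + int q - lam + lam + T}"
    using q(2) d G_D(3)[OF jG] by (simp add: \<tau>)
  ultimately show "calibrated lam T sched m \<tau>" unfolding calibrated_def by blast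
qed

text \<open>The job determines its block, disjointness of the batches the step, and injectivity of
  \<open>pick\<close> the machine.\<close>

lemma processes_sched_ex1:
  assumes "j \<in> J"
  shows "\<exists>!(\<tau>, m). processes (sched \<tau>) m = Some j"
proof -
  define i where "i = (release j + lam) div B"
  have jG: "j \<in> G i" using assms by (simp add: group_def i_def)
  obtain k where k: "j \<in> batch lam B J i k" using batch_ex1[OF jG] by blast
  obtain n where n: "pick (batch lam B J i k) n = Some j"
    using pick_ex1[OF finite_batch k] by blast
  let ?z = "(i * B + int k, prod_encode (int_encode i, n))"
  show ?thesis
  proof (rule ex1I[of _ ?z])
    show "case ?z of (\<tau>, m) \<Rightarrow> processes (sched \<tau>) m = Some j"
      using n by (simp add: processes_sched)
  next
    fix z :: "int \<times> nat" assume z: "case z of (\<tau>, m) \<Rightarrow> processes (sched \<tau>) m = Some j"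
    obtain \<tau> m where zm: "z = (\<tau>, m)" by fastforce
    obtain i' n' where s: "slot m = (i', n')" by fastforce
    have p: "i' * B \<le> \<tau>" "pick (batch lam B J i' (nat (\<tau> - i' * B))) n' = Some j"
      using z zm s by (auto simp: processes_sched)
    have j: "j \<in> batch lam B J i' (nat (\<tau> - i' * B))"
      using pick_SomeD(1)[OF finite_batch p(2)] .
    then have "j \<in> G i'" using batch_subset by blast
    then have i': "i' = i" using G_D(5)[of j i'] by (simp add: i_def)
    then have k': "nat (\<tau> - i' * B) = k" using batch_ex1[OF jG] j k by blast
    then have "n' = n" using pick_ex1[OF finite_batch k] n p(2) i' by blast
    then show "z = ?z" using zm s i' k' p(1) by (auto simp: slot_eq_iff)
  qed
qed

lemma feasible_sched: "feasible lam T J sched"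
  unfolding feasible_def
proof (intro conjI allI impI ballI)
  show "finite (calibrations sched)" using calibrations_sched_bound by blast
next
  fix m t t'
  assume "(t, m) \<in> calibrations sched \<and> (t', m) \<in> calibrations sched \<and> t \<noteq> t'"
  then show "{t..<t + lam + T} \<inter> {t'..<t' + lam + T} = {}"
    using calibration_unique by blast
qed (use processes_schedD processes_sched_ex1 in \<open>simp_all\<close>)

text \<open>
  A job that \<open>S\<close> processes at time \<open>\<tau>\<close> can be postponed to \<open>max \<tau> (release j + lam)\<close>,
  that is, by at most \<open>lam\<close>. So \<open>lam + 1\<close> shifted copies of every calibration of \<open>S\<close>
  accommodate all jobs with release times increased by \<open>lam\<close>.
\<close>
lemma demand_le_card_shifts:
  assumes S: "feasible lam T J S"
  shows "demand lam B J i \<le>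
    card {p \<in> calibrations S \<times> {0..lam}. \<bar>fst (fst p) + lam + snd p - i * B\<bar> < T}"
    (is "_ \<le> card ?P")
  unfolding demand_def
proof (rule density_le)
  fix a b :: nat
  let ?X = "{j \<in> G i. a \<le> rel lam B i j \<and> due B i j \<le> b}"
  have fin: "finite (calibrations S)" using S by (simp add: feasible_def)
  have "\<forall>j\<in>J. \<exists>\<tau> m c. processes (S \<tau>) m = Some j \<and> (c, m) \<in> calibrations S \<and>
      c + lam \<le> \<tau> \<and> \<tau> < c + lam + T \<and> release j \<le> \<tau> \<and> \<tau> + 1 \<le> deadline j"
  proof
    fix j assume "j \<in> J"
    then have "\<exists>!(\<tau>, m). processes (S \<tau>) m = Some j" using S unfolding feasible_def by blast
    then obtain \<tau> m where p: "processes (S \<tau>) m = Some j" by auto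
    then have "calibrated lam T S m \<tau> \<and> release j \<le> \<tau> \<and> \<tau> + 1 \<le> deadline j"
      using S unfolding feasible_def by blast
    then show "\<exists>\<tau> m c. processes (S \<tau>) m = Some j \<and> (c, m) \<in> calibrations S \<and>
      c + lam \<le> \<tau> \<and> \<tau> < c + lam + T \<and> release j \<le> \<tau> \<and> \<tau> + 1 \<le> deadline j"
      using p unfolding calibrated_def by auto
  qed
  then obtain \<tau> m c where S_job: "\<And>j. j \<in> J \<Longrightarrow> processes (S (\<tau> j)) (m j) = Some j \<and>
      (c j, m j) \<in> calibrations S \<and> c j + lam \<le> \<tau> j \<and> \<tau> j < c j + lam + T \<and>
      release j \<le> \<tau> j \<and> \<tau> j + 1 \<le> deadline j"
    by metis
  define s where "s j = max (\<tau> j) (release j + lam)" for j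
  \<comment> \<open>A job is sent to a translate of a calibration and a time within the block.
    Together they recover the machine and the time \<open>\<tau> j\<close> used by \<open>S\<close>,
    hence the job.\<close>
  define g where "g j = (((c j, m j), s j - \<tau> j), nat (s j - i * B))" for j
  have s_ge: "i * B \<le> s j" if "j \<in> ?X" for j
    using that G_D(2)[of j i] by (auto simp: s_def)
  have "inj_on g ?X"
  proof (rule inj_onI)
    fix j j' assume jj: "j \<in> ?X" "j' \<in> ?X" "g j = g j'"
    then have "m j = m j'" "s j - \<tau> j = s j' - \<tau> j'" "s j = s j'"
      using s_ge[OF jj(1)] s_ge[OF jj(2)] by (auto simp: g_def)
    then have "m j = m j'" "\<tau> j = \<tau> j'" by auto
    then show "j = j'"
      using S_job[of j] S_job[of j'] jj G_D(1)
      by (metis (no_types, lifting) mem_Collect_eq option.inject)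
  qed
  moreover have "g ` ?X \<subseteq> ?P \<times> {a..<b}"
  proof
    fix z assume "z \<in> g ` ?X"
    then obtain j where j: "j \<in> ?X" "z = g j" by blast
    have jG: "j \<in> G i" using j(1) by simp
    note job = S_job[OF G_D(1)[OF jG]] G_D(2,3)[OF jG] window[OF G_D(1)[OF jG]]
    have s1: "\<tau> j \<le> s j" "s j \<le> \<tau> j + lam" "release j + lam \<le> s j" "s j < deadline j"
      using job lam by (auto simp: s_def)
    \<comment> \<open>Both the translate and the block's interval have length \<open>T\<close> and
      contain \<open>s j\<close>, so their left ends differ by less than \<open>T\<close>.\<close>
    have "\<bar>c j + lam + (s j - \<tau> j) - i * B\<bar> < T"
      using s1 job by linarith
    moreover have "a \<le> nat (s j - i * B)" "nat (s j - i * B) < b"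
      using j(1) s1 job by (auto simp: rel_def due_def)
    ultimately show "z \<in> ?P \<times> {a..<b}"
      using j(2) job s1 by (auto simp: g_def)
  qed
  ultimately have "card ?X \<le> card (?P \<times> {a..<b})"
    using fin by (intro card_inj_on_le) auto
  then show "card ?X \<le> card ?P * (b - a)" by (simp add: card_cartesian_product)
qed

text \<open>Double counting of the pairs of a translate and a block whose intervals meet.\<close>

lemma cost_sched_le:
  assumes S: "feasible lam T J S"
  shows "int (cost sched) \<le> 3 * (int (cost S) * (lam + 1) * ((2 * T - 2) div B + 1))"
proof -
  let ?I = "(\<lambda>j. (release j + lam) div B) ` J"
  let ?C = "calibrations S \<times> {0..lam}"
  let ?near = "\<lambda>p i. \<bar>fst (fst p) + lam + snd p - i * B\<bar> < T"
  have finI: "finite ?I" using finite_J by simp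
  have finC: "finite ?C" using S by (simp add: feasible_def)
  have "(\<Sum>i\<in>?I. demand lam B J i) \<le> (\<Sum>i\<in>?I. card {p \<in> ?C. ?near p i})"
    by (intro sum_mono demand_le_card_shifts S)
  also have "\<dots> = (\<Sum>i\<in>?I. \<Sum>p\<in>?C. if ?near p i then 1 else 0)"
    using sum.inter_filter[OF finC, of "\<lambda>_. 1 :: nat"] by (intro sum.cong) auto
  also have "\<dots> = (\<Sum>p\<in>?C. \<Sum>i\<in>?I. if ?near p i then 1 else 0)"
    by (rule sum.swap)
  also have "\<dots> = (\<Sum>p\<in>?C. card {i \<in> ?I. ?near p i})"
    using sum.inter_filter[OF finI, of "\<lambda>_. 1 :: nat"] by (intro sum.cong) auto
  finally have "(\<Sum>i\<in>?I. demand lam B J i) \<le> (\<Sum>p\<in>?C. card {i \<in> ?I. ?near p i})" .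
  then have "int (\<Sum>i\<in>?I. demand lam B J i) \<le> (\<Sum>p\<in>?C. int (card {i \<in> ?I. ?near p i}))"
    by (simp only: of_nat_sum[symmetric] of_nat_le_iff)
  also have "\<dots> \<le> (\<Sum>p\<in>?C. (2 * T - 2) div B + 1)"
  proof (rule sum_mono)
    fix p
    have "card {i \<in> ?I. ?near p i} \<le> card {i. ?near p i}"
      using card_near_multiples[OF B T, of "fst (fst p) + lam + snd p"] by (intro card_mono) auto
    then show "int (card {i \<in> ?I. ?near p i}) \<le> (2 * T - 2) div B + 1"
      using card_near_multiples[OF B T, of "fst (fst p) + lam + snd p"] by linarith
  qed
  also have "\<dots> = int (cost S) * (lam + 1) * ((2 * T - 2) div B + 1)"
    using lam by (simp add: card_cartesian_product cost_def)
  finally show ?thesis using calibrations_sched_bound by linarith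
qed

end

theorem theorem2:
  fixes \<alpha> :: real and lam :: int
  assumes "0 < \<alpha>" and "\<alpha> < 1" and "0 \<le> lam"
  shows "\<exists>A :: online_algorithm.
    competitive lam (short_window_instances \<alpha> lam) A
      ((exp 1 + 1) * (of_int lam + 1) * of_int \<lceil>2 / (1 - \<alpha>)\<rceil>)"
proof -
  \<comment> \<open>Shrunk windows have integer length below \<open>\<alpha> * T\<close>, hence at
    most \<open>T - B T\<close>. Moreover \<open>B T\<close> is at least
    \<open>(1 - \<alpha>) * T\<close>.\<close>
  define B where "B T = T - \<lfloor>\<alpha> * real_of_int T\<rfloor>" for T :: int
  define A :: online_algorithm where "A T t K = block_decision lam (B T) t K" for T t K
  define c where "c = (exp 1 + 1) * (real_of_int lam + 1) * real_of_int \<lceil>2 / (1 - \<alpha>)\<rceil>"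
  have "feasible lam T J (run A T J) \<and> real (cost (run A T J)) \<le> c * real (opt lam T J) + 0"
    if inst: "(T, J) \<in> short_window_instances \<alpha> lam" for T J
  proof -
    have I: "(T, J) \<in> instances lam" using inst by (auto simp: short_window_instances_def)
    then have T: "0 < T" by (simp add: instances_def)
    have BT: "(1 - \<alpha>) * T \<le> B T"
      using of_int_floor_le[of "\<alpha> * T"] by (simp add: B_def algebra_simps)
    moreover have pos: "0 < (1 - \<alpha>) * T" using assms(2) T by simp
    ultimately have B: "0 < B T" by linarith
    interpret short_jobs lam T "B T" J
    proof
      fix j assume j: "j \<in> J"
      show "release j + lam < deadline j"
        using I j by (force simp: instances_def)
      have "real_of_int (deadline j - release j - lam) \<le> \<alpha> * T"
        using inst j by (force simp: short_window_instances_def)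
      then have "deadline j - release j - lam \<le> \<lfloor>\<alpha> * T\<rfloor>" by (simp add: le_floor_iff)
      then show "deadline j \<le> release j + lam + T - B T" by (simp add: B_def)
    qed (use I T B assms in \<open>auto simp: instances_def\<close>)
    have run: "run A T J = sched"
      by (simp add: run_def sched_def A_def known_def fun_eq_iff)
    obtain S where S: "feasible lam T J S" "cost S = opt lam T J"
      using opt_attained(1)[OF I assms(3)] by blast
    have q: "(2 * T - 2) div B T + 1 \<le> \<lceil>2 / (1 - \<alpha>)\<rceil>"
    proof -
      have "real_of_int ((2 * T - 2) div B T) \<le> real_of_int (2 * T - 2) / real_of_int (B T)"
        by (rule real_of_int_div4)
      \<comment> \<open>Strictness, gained from the \<open>- 2\<close>, lets the ceiling absorb the
        extra \<open>+ 1\<close>.\<close>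
      also have "\<dots> < 2 * T / B T"
        using B by (intro divide_strict_right_mono) auto
      also have "\<dots> \<le> 2 * T / ((1 - \<alpha>) * T)"
        using BT pos T by (intro divide_left_mono) auto
      also have "\<dots> = 2 / (1 - \<alpha>)" using T by simp
      finally show ?thesis by (simp add: less_ceiling_iff add1_zle_eq)
    qed
    have "real (cost sched) \<le>
        real_of_int (3 * (int (opt lam T J) * (lam + 1) * ((2 * T - 2) div B T + 1)))"
      using cost_sched_le[OF S(1)] unfolding S(2) by linarith
    also have "\<dots> \<le> real_of_int (3 * (int (opt lam T J) * (lam + 1) * \<lceil>2 / (1 - \<alpha>)\<rceil>))"
      unfolding of_int_le_iff using q assms(3) by (intro mult_left_mono) auto
    also have "\<dots> = 3 * ((real_of_int lam + 1) * \<lceil>2 / (1 - \<alpha>)\<rceil> * real (opt lam T J))"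
      by simp
    also have "\<dots> \<le> (exp 1 + 1) * ((real_of_int lam + 1) * \<lceil>2 / (1 - \<alpha>)\<rceil> * real (opt lam T J))"
    proof (rule mult_right_mono)
      show "(3 :: real) \<le> exp 1 + 1" using exp_ge_add_one_self[of "1 :: real"] by simp
      have "0 \<le> 2 / (1 - \<alpha>)" using assms(2) by simp
      then have "0 \<le> \<lceil>2 / (1 - \<alpha>)\<rceil>" by linarith
      then show "0 \<le> (real_of_int lam + 1) * \<lceil>2 / (1 - \<alpha>)\<rceil> * real (opt lam T J)"
        using assms(3) by simp
    qed
    finally show ?thesis
      using feasible_sched unfolding run c_def by (simp add: mult.assoc)
  qed
  then show ?thesis
    unfolding competitive_def c_def[symmetric] by (intro exI[of _ A] exI[of _ 0]) auto
qed

end
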